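(* Let $M$ be a 7-dimensional manifold with a $G_2^*$ structure $\varphi$, let $\xi$ be a vector field on $M$ with $g_{4,3}(\xi,\xi)=-1$, and let $(\phi,\xi,\eta,g)$ be the almost paracontact metric structure induced by $\varphi$ and $\xi$. Assume that $\xi$ is Killing. Then the component $F^{9}$ of $\nabla\Phi$ vanishes identically if and only if $$\eta(Y)\big(P(\nabla_X\xi,\xi)+\nabla_{\phi X}\xi\big)+\big(g(\nabla_{\phi Y}\xi,X)-g(\nabla_{\phi X}\xi,Y)\big)\xi=0$$ for all vector fields $X,Y$.
   Context: $G_2^*$ structures: on $\mathbb{R}^7$ with standard basis $e_1,\dots,e_7$ and dual basis $e^1,\dots,e^7$, let $g_{4,3}$ be the metric of signature $(-,-,-,-,+,+,+)$ for which the basis is orthonormal (the first four vectors having square $-1$), and let $\varphi_0=-e^{127}-e^{135}+e^{146}+e^{236}+e^{245}-e^{347}+e^{567}$, where $e^{ijk}=e^i\wedge e^j\wedge e^k$. $G_2^*$ is the stabilizer of $\varphi_0$ in $GL(7,\mathbb{R})$; it preserves $g_{4,3}$. A $G_2^*$ structure on a smooth oriented 7-manifold $M$ is a smooth 3-form $\varphi$ such that $(T_pM,\varphi_p)$ is isomorphic to $(\mathbb{R}^7,\varphi_0)$ for every $p\in M$. It induces a semi-Riemannian metric, also denoted $g_{4,3}$ (transported pointwise through these isomorphisms), and a cross product $P$ defined by $\varphi(X,Y,Z)=g_{4,3}(P(X,Y),Z)$. Induced almost paracontact metric structure: given a vector field $\xi$ with $g_{4,3}(\xi,\xi)=-1$,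 set $\phi(X)=P(\xi,X)$, $g=-g_{4,3}$, $\eta(X)=g(\xi,X)$. Then $\phi^2=I-\eta\otimes\xi$, $\eta(\xi)=1$, $g(\phi X,\phi Y)=-g(X,Y)+\eta(X)\eta(Y)$. The metrics $g$ and $g_{4,3}$ have the same Levi-Civita connection $\nabla$. The fundamental 2-form is $\Phi(X,Y)=g(\phi X,Y)$ and $F(X,Y,Z)=(\nabla_X\Phi)(Y,Z)$. $\xi$ is Killing if $g(\nabla_X\xi,Y)=-g(\nabla_Y\xi,X)$ for all $X,Y$. The component (projection) of $F$ on the class $\mathbb{G}_{9}$ of the classification of almost paracontact metric structures is $$\begin{aligned}F^{9}(X,Y,Z)=&-\tfrac14\eta(Y)\{F(\phi^2X,\phi^2Z,\xi)+F(\phi X,\phi Z,\xi)-F(\phi^2Z,\phi^2X,\xi)-F(\phi Z,\phi X,\xi)\}\\&+\tfrac14\eta(Z)\{F(\phi^2X,\phi^2Y,\xi)+F(\phi X,\phi Y,\xi)-F(\phi^2Y,\phi^2X,\xi)-F(\phi Y,\phi X,\xi)\}.\end{aligned}$$ *)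

theory Defs
  imports "HOL-Analysis.Analysis"
begin

text \<open>The derivatives are taken with \<^term>\<open>at x\<close>, not within \<open>S\<close>, so these notions are meant for open \<open>S\<close>.\<close>

fun Ck_on :: "nat \<Rightarrow> ('b::euclidean_space) set \<Rightarrow> ('b \<Rightarrow> 'c::real_normed_vector) \<Rightarrow> bool" where
  "Ck_on 0 S f \<longleftrightarrow> continuous_on S f"
| "Ck_on (Suc k) S f \<longleftrightarrow>
     (\<forall>x\<in>S. f differentiable (at x)) \<and>
     (\<forall>v. Ck_on k S (\<lambda>x. frechet_derivative f (at x) v))"

definition smooth_on :: "('b::euclidean_space) set \<Rightarrow> ('b \<Rightarrow> 'c::real_normed_vector) \<Rightarrow> bool" where
  "smooth_on S f \<longleftrightarrow> (\<forall>k. Ck_on k S f)"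

text \<open>
  The manifold is a whole Hausdorff, second countable type \<open>'a\<close> together with an atlas.
  A chart is a pair of a domain and a coordinate map; the coordinate map is unspecified
  outside the domain.
\<close>

type_synonym 'a chart = "'a set \<times> ('a \<Rightarrow> real^7)"

abbreviation chart_dom :: "'a chart \<Rightarrow> 'a set" where
  "chart_dom K \<equiv> fst K"

abbreviation chart_map :: "'a chart \<Rightarrow> 'a \<Rightarrow> real^7" where
  "chart_map K \<equiv> snd K"

definition chart_img :: "'a chart \<Rightarrow> (real^7) set" where
  "chart_img K = chart_map K ` chart_dom K"

definition chart_inv :: "'a chart \<Rightarrow> real^7 \<Rightarrow> 'a" where
  "chart_inv K = inv_into (chart_dom K) (chart_map K)"

text \<open>The differential at \<open>p\<close> of the transition map from \<open>K\<close> to \<open>L\<close>.\<close>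

definition coord_change :: "'a chart \<Rightarrow> 'a chart \<Rightarrow> 'a \<Rightarrow> real^7 \<Rightarrow> real^7" where
  "coord_change K L p = frechet_derivative (chart_map L \<circ> chart_inv K) (at (chart_map K p))"

definition oriented_smooth_atlas :: "('a::{t2_space,second_countable_topology}) chart set \<Rightarrow> bool" where
  "oriented_smooth_atlas A \<longleftrightarrow>
     (\<Union>K\<in>A. chart_dom K) = UNIV \<and>
     (\<forall>K\<in>A. open (chart_dom K) \<and> open (chart_img K) \<and>
        homeomorphism (chart_dom K) (chart_img K) (chart_map K) (chart_inv K)) \<and>
     (\<forall>K\<in>A. \<forall>L\<in>A.
        smooth_on (chart_map K ` (chart_dom K \<inter> chart_dom L)) (chart_map L \<circ> chart_inv K) \<and>
        (\<forall>p \<in> chart_dom K \<inter> chart_dom L. 0 < det (matrix (coord_change K L p))))"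

text \<open>
  The tangent space at \<open>p\<close> is represented by \<open>\<real>\<^sup>7\<close> through the differential at \<open>p\<close> of
  a chart \<open>chart_at A p\<close> chosen once and for all around \<open>p\<close>. Since \<open>chart_at A p\<close> need not
  depend continuously on \<open>p\<close>, smoothness of vector fields and forms is
  not smoothness of the representing functions; it is expressed in each fixed chart of the
  atlas, after the change of coordinates between that chart and \<open>chart_at A p\<close>.
\<close>

definition chart_at :: "'a chart set \<Rightarrow> 'a \<Rightarrow> 'a chart" where
  "chart_at A p = (SOME K. K \<in> A \<and> p \<in> chart_dom K)"

type_synonym 'a vfield = "'a \<Rightarrow> real^7"

definition smooth_fun :: "'a chart set \<Rightarrow> ('a \<Rightarrow> real) \<Rightarrow> bool" where
  "smooth_fun A f \<longleftrightarrow> (\<forall>K\<in>A. smooth_on (chart_img K) (f \<circ> chart_inv K))"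

definition local_rep :: "'a chart set \<Rightarrow> 'a chart \<Rightarrow> 'a vfield \<Rightarrow> real^7 \<Rightarrow> real^7" where
  "local_rep A K X u = (let p = chart_inv K u in coord_change (chart_at A p) K p (X p))"

definition smooth_vfield :: "'a chart set \<Rightarrow> 'a vfield \<Rightarrow> bool" where
  "smooth_vfield A X \<longleftrightarrow> (\<forall>K\<in>A. smooth_on (chart_img K) (local_rep A K X))"

text \<open>The derivative of the function \<open>f\<close> at \<open>p\<close> along the tangent vector \<open>v\<close>.\<close>

definition dir_deriv :: "'a chart set \<Rightarrow> 'a \<Rightarrow> real^7 \<Rightarrow> ('a \<Rightarrow> real) \<Rightarrow> real" where
  "dir_deriv A p v f =
     frechet_derivative (f \<circ> chart_inv (chart_at A p)) (at (chart_map (chart_at A p) p)) v"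

text \<open>
  The coordinate formula \<open>[X,Y] = DY(X) - DX(Y)\<close> in the chart \<open>chart_at A p\<close>, in which
  the coordinates of \<open>X\<close> and \<open>Y\<close> at \<open>p\<close> are \<open>X p\<close> and \<open>Y p\<close> themselves.
\<close>

definition lie_bracket :: "'a chart set \<Rightarrow> 'a vfield \<Rightarrow> 'a vfield \<Rightarrow> 'a vfield" where
  "lie_bracket A X Y p =
     (let K = chart_at A p in
        frechet_derivative (local_rep A K Y) (at (chart_map K p)) (X p)
      - frechet_derivative (local_rep A K X) (at (chart_map K p)) (Y p))"

text \<open>The index type of \<open>real^7\<close> has \<open>7 = 0\<close>, so \<open>1, \<dots>, 7\<close> are its seven distinct elements.\<close>

type_synonym form3 = "real^7 \<Rightarrow> real^7 \<Rightarrow> real^7 \<Rightarrow> real"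

definition wedge3 :: "7 \<Rightarrow> 7 \<Rightarrow> 7 \<Rightarrow> form3" where
  "wedge3 i j k x y z =
     det (vector [vector [x $ i, x $ j, x $ k],
                  vector [y $ i, y $ j, y $ k],
                  vector [z $ i, z $ j, z $ k]] :: real^3^3)"

definition phi0 :: form3 where
  "phi0 x y z =
     - wedge3 1 2 7 x y z - wedge3 1 3 5 x y z + wedge3 1 4 6 x y z + wedge3 2 3 6 x y z
     + wedge3 2 4 5 x y z - wedge3 3 4 7 x y z + wedge3 5 6 7 x y z"

definition g0 :: "real^7 \<Rightarrow> real^7 \<Rightarrow> real" where
  "g0 x y = - (x$1 * y$1) - x$2 * y$2 - x$3 * y$3 - x$4 * y$4
            + x$5 * y$5 + x$6 * y$6 + x$7 * y$7"

definition alternating_3form :: "form3 \<Rightarrow> bool" where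
  "alternating_3form w \<longleftrightarrow>
     (\<forall>y z. linear (\<lambda>x. w x y z)) \<and> (\<forall>x z. linear (\<lambda>y. w x y z)) \<and> (\<forall>x y. linear (\<lambda>z. w x y z)) \<and>
     (\<forall>x y. w x x y = 0 \<and> w x y x = 0 \<and> w y x x = 0)"

definition g2_star_iso :: "form3 \<Rightarrow> (real^7 \<Rightarrow> real^7) \<Rightarrow> bool" where
  "g2_star_iso w T \<longleftrightarrow> linear T \<and> bij T \<and> (\<forall>x y z. w x y z = phi0 (T x) (T y) (T z))"

text \<open>
  Two isomorphisms differ by an element of \<open>G\<^sub>2\<^sup>*\<close>, which preserves \<^term>\<open>g0\<close>, so the
  transported metric does not depend on the choice of \<open>T\<close>.
\<close>

definition g43 :: "form3 \<Rightarrow> real^7 \<Rightarrow> real^7 \<Rightarrow> real" where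
  "g43 w x y = (let T = (SOME T. g2_star_iso w T) in g0 (T x) (T y))"

definition cross_prod :: "form3 \<Rightarrow> real^7 \<Rightarrow> real^7 \<Rightarrow> real^7" where
  "cross_prod w x y = (THE v. \<forall>z. w x y z = g43 w v z)"

text \<open>
  Smoothness of a 3-form: in every chart \<open>K\<close>, its values on coordinate
  vector fields with constant coordinates \<open>a, b, c\<close> are smooth.
\<close>

definition smooth_3form :: "'a chart set \<Rightarrow> ('a \<Rightarrow> form3) \<Rightarrow> bool" where
  "smooth_3form A \<phi> \<longleftrightarrow>
     (\<forall>p. alternating_3form (\<phi> p)) \<and>
     (\<forall>K\<in>A. \<forall>a b c. smooth_on (chart_img K)
        (\<lambda>u. let p = chart_inv K u; E = coord_change K (chart_at A p) p
             in \<phi> p (E a) (E b) (E c)))"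

definition g2_star_structure :: "'a chart set \<Rightarrow> ('a \<Rightarrow> form3) \<Rightarrow> bool" where
  "g2_star_structure A \<phi> \<longleftrightarrow> smooth_3form A \<phi> \<and> (\<forall>p. \<exists>T. g2_star_iso (\<phi> p) T)"

text \<open>
  \<open>nabla Y p x\<close> is the covariant derivative at \<open>p\<close> of the field \<open>Y\<close> along the tangent
  vector \<open>x\<close>; only its values on smooth \<open>Y\<close> are constrained.
\<close>

type_synonym 'a connection = "'a vfield \<Rightarrow> 'a \<Rightarrow> real^7 \<Rightarrow> real^7"

definition cov :: "'a connection \<Rightarrow> 'a vfield \<Rightarrow> 'a vfield \<Rightarrow> 'a vfield" where
  "cov nabla X Y p = nabla Y p (X p)"

definition affine_connection :: "'a chart set \<Rightarrow> 'a connection \<Rightarrow> bool" where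
  "affine_connection A nabla \<longleftrightarrow>
     (\<forall>Y p. smooth_vfield A Y \<longrightarrow> linear (nabla Y p)) \<and>
     (\<forall>X Y. smooth_vfield A X \<longrightarrow> smooth_vfield A Y \<longrightarrow> smooth_vfield A (cov nabla X Y)) \<and>
     (\<forall>Y Z p x. smooth_vfield A Y \<longrightarrow> smooth_vfield A Z \<longrightarrow>
        nabla (\<lambda>q. Y q + Z q) p x = nabla Y p x + nabla Z p x) \<and>
     (\<forall>f Y p x. smooth_fun A f \<longrightarrow> smooth_vfield A Y \<longrightarrow>
        nabla (\<lambda>q. f q *\<^sub>R Y q) p x = dir_deriv A p x f *\<^sub>R Y p + f p *\<^sub>R nabla Y p x)"

definition levi_civita ::
  "'a chart set \<Rightarrow> ('a \<Rightarrow> real^7 \<Rightarrow> real^7 \<Rightarrow> real) \<Rightarrow> 'a connection \<Rightarrow> bool" where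
  "levi_civita A h nabla \<longleftrightarrow>
     affine_connection A nabla \<and>
     (\<forall>X Y p. smooth_vfield A X \<longrightarrow> smooth_vfield A Y \<longrightarrow>
        cov nabla X Y p - cov nabla Y X p = lie_bracket A X Y p) \<and>
     (\<forall>X Y Z p. smooth_vfield A X \<longrightarrow> smooth_vfield A Y \<longrightarrow> smooth_vfield A Z \<longrightarrow>
        dir_deriv A p (X p) (\<lambda>q. h q (Y q) (Z q)) =
          h p (cov nabla X Y p) (Z p) + h p (Y p) (cov nabla X Z p))"

definition pc_metric :: "('a \<Rightarrow> form3) \<Rightarrow> 'a \<Rightarrow> real^7 \<Rightarrow> real^7 \<Rightarrow> real" where
  "pc_metric \<phi> p x y = - g43 (\<phi> p) x y"

definition pc_phi :: "('a \<Rightarrow> form3) \<Rightarrow> 'a vfield \<Rightarrow> 'a vfield \<Rightarrow> 'a vfield" where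
  "pc_phi \<phi> \<xi> X p = cross_prod (\<phi> p) (\<xi> p) (X p)"

definition pc_eta :: "('a \<Rightarrow> form3) \<Rightarrow> 'a vfield \<Rightarrow> 'a vfield \<Rightarrow> 'a \<Rightarrow> real" where
  "pc_eta \<phi> \<xi> X p = pc_metric \<phi> p (\<xi> p) (X p)"

definition fund_form :: "('a \<Rightarrow> form3) \<Rightarrow> 'a vfield \<Rightarrow> 'a vfield \<Rightarrow> 'a vfield \<Rightarrow> 'a \<Rightarrow> real" where
  "fund_form \<phi> \<xi> X Y p = pc_metric \<phi> p (pc_phi \<phi> \<xi> X p) (Y p)"

text \<open>
  \<open>g43\<close> is smooth (it is a smooth function of \<open>\<phi>\<close>), hence \<^term>\<open>pc_phi \<phi> \<xi> X\<close> is a smooth field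
  and \<^term>\<open>fund_form \<phi> \<xi> Y Z\<close> a smooth function whenever \<open>X, Y, Z, \<xi>\<close> are. So the
  covariant derivatives below are only taken of smooth fields when \<open>X, Y, Z\<close> are smooth.
\<close>

definition F_tensor ::
  "'a chart set \<Rightarrow> ('a \<Rightarrow> form3) \<Rightarrow> 'a vfield \<Rightarrow> 'a connection \<Rightarrow>
   'a vfield \<Rightarrow> 'a vfield \<Rightarrow> 'a vfield \<Rightarrow> 'a \<Rightarrow> real" where
  "F_tensor A \<phi> \<xi> nabla X Y Z p =
     dir_deriv A p (X p) (fund_form \<phi> \<xi> Y Z)
     - fund_form \<phi> \<xi> (cov nabla X Y) Z p
     - fund_form \<phi> \<xi> Y (cov nabla X Z) p"

definition F9 ::
  "'a chart set \<Rightarrow> ('a \<Rightarrow> form3) \<Rightarrow> 'a vfield \<Rightarrow> 'a connection \<Rightarrow>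
   'a vfield \<Rightarrow> 'a vfield \<Rightarrow> 'a vfield \<Rightarrow> 'a \<Rightarrow> real" where
  "F9 A \<phi> \<xi> nabla X Y Z p =
     (let F = F_tensor A \<phi> \<xi> nabla; f = pc_phi \<phi> \<xi>; \<eta> = pc_eta \<phi> \<xi> in
        - (1/4) * \<eta> Y p *
            (F (f (f X)) (f (f Z)) \<xi> p + F (f X) (f Z) \<xi> p
             - F (f (f Z)) (f (f X)) \<xi> p - F (f Z) (f X) \<xi> p)
        + (1/4) * \<eta> Z p *
            (F (f (f X)) (f (f Y)) \<xi> p + F (f X) (f Y) \<xi> p
             - F (f (f Y)) (f (f X)) \<xi> p - F (f Y) (f X) \<xi> p))"

definition killing ::
  "'a chart set \<Rightarrow> ('a \<Rightarrow> form3) \<Rightarrow> 'a connection \<Rightarrow> 'a vfield \<Rightarrow> bool" where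
  "killing A \<phi> nabla \<xi> \<longleftrightarrow>
     (\<forall>X Y p. smooth_vfield A X \<longrightarrow> smooth_vfield A Y \<longrightarrow>
        pc_metric \<phi> p (cov nabla X \<xi> p) (Y p) = - pc_metric \<phi> p (cov nabla Y \<xi> p) (X p))"

end

theory Submission
  imports Defs
begin

text \<open>
  Since \<open>\<Phi>(\<cdot>, \<xi>) = 0\<close>, one has \<open>F(X, Y, \<xi>) = - g(\<phi> Y, \<nabla>\<^sub>X \<xi>)\<close>, so \<open>F\<^sup>9\<close> at a
  point only involves the endomorphism \<open>B x = \<nabla>\<^sub>x \<xi>\<close>. It is skew because \<open>\<xi>\<close> is Killing,
  and \<open>g(B x, \<xi>) = 0\<close> because \<open>\<xi>\<close> has constant length. Together with \<open>\<phi>\<^sup>2 = I - \<eta> \<otimes> \<xi>\<close>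
  and the skewness of \<open>\<phi>\<close> this shows that the inner product \<open>g(\<cdot>, Z)\<close> of the vector in the theorem is
  exactly \<open>2 F\<^sup>9(X, Y, Z)\<close>. Nondegeneracy of \<open>g\<close> concludes, since by bump functions every tangent
  vector is the value of a smooth vector field.
\<close>

subsection \<open>Functions of class \<open>C\<^sup>k\<close> and bump functions\<close>

text \<open>Derivatives \<open>at x\<close> only see values near \<open>x\<close>, and
  \<open>S\<close> is open, so agreement on \<open>S\<close> alone carries over to every derivative
  there.\<close>

lemma Ck_on_cong:
  assumes "open S" "\<And>x. x \<in> S \<Longrightarrow> f x = g x" "Ck_on k S f"
  shows "Ck_on k S g"
  using assms(2,3)
proof (induction k arbitrary: f g)
  case 0
  then show ?case by (metis Ck_on.simps(1) continuous_on_cong)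
next
  case (Suc k)
  have "(g has_derivative frechet_derivative f (at x)) (at x)" if "x \<in> S" for x
    using Suc.prems that assms(1)
    by (auto simp: frechet_derivative_works intro: has_derivative_transform_within_open)
  then have "g differentiable (at x)" "frechet_derivative f (at x) = frechet_derivative g (at x)"
    if "x \<in> S" for x
    using that by (auto simp: differentiable_def frechet_derivative_at)
  moreover have "Ck_on k S (\<lambda>x. frechet_derivative g (at x) v)" for v
    by (rule Suc.IH[of "\<lambda>x. frechet_derivative f (at x) v"]) (use Suc.prems calculation in auto)
  ultimately show ?case by simp
qed

text \<open>Lets the inductions below work with an explicit formula for the derivative on
  \<open>S\<close> in place of the chosen \<open>frechet_derivative\<close>.\<close>

lemma Ck_on_SucI:
  assumes "open S" "\<And>x. x \<in> S \<Longrightarrow> (f has_derivative f' x) (at x)"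
    and "\<And>v. Ck_on k S (\<lambda>x. f' x v)"
  shows "Ck_on (Suc k) S f"
proof -
  have "Ck_on k S (\<lambda>x. frechet_derivative f (at x) v)" for v
    by (rule Ck_on_cong[OF assms(1) _ assms(3)[of v]]) (rule fun_cong[OF frechet_derivative_at[OF assms(2)]])
  then show ?thesis using assms(2) by (auto simp: differentiable_def)
qed

lemma Ck_on_imp_continuous_on: "Ck_on k S f \<Longrightarrow> continuous_on S f"
  by (cases k)
    (auto intro: continuous_at_imp_continuous_on differentiable_imp_continuous_within)

text \<open>The recursion does not list the lower orders. They come from the base case, where
  differentiability gives continuity, applied to ever higher directional derivatives.\<close>

lemma Ck_on_SucD: "Ck_on (Suc k) S f \<Longrightarrow> Ck_on k S f"
proof (induction k arbitrary: f)
  case 0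
  then show ?case by (metis Ck_on.simps(1) Ck_on_imp_continuous_on)
next
  case (Suc k)
  then show ?case by (metis Ck_on.simps(2))
qed

lemma Ck_on_Un:
  assumes "open S" "open T" "Ck_on k S f" "Ck_on k T f"
  shows "Ck_on k (S \<union> T) f"
  using assms(3,4) by (induction k arbitrary: f) (auto intro: continuous_on_open_Un assms)

lemma Ck_on_const: "Ck_on k S (\<lambda>x. c)"
  by (induction k arbitrary: c) auto

lemma Ck_on_bounded_linear:
  assumes "bounded_linear h" "open S" "Ck_on k S f"
  shows "Ck_on k S (\<lambda>x. h (f x))"
  using assms(3)
proof (induction k arbitrary: f)
  case 0
  then show ?case using bounded_linear.continuous_on[OF assms(1)] by simp
next
  case (Suc k)
  show ?case
  proof (rule Ck_on_SucI[OF assms(2)])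
    show "((\<lambda>x. h (f x)) has_derivative (\<lambda>v. h (frechet_derivative f (at x) v))) (at x)"
      if "x \<in> S" for x
      using Suc.prems that bounded_linear.has_derivative[OF assms(1)]
      by (auto simp: frechet_derivative_works)
  qed (use Suc in auto)
qed

lemma Ck_on_ident: "open S \<Longrightarrow> Ck_on k S (\<lambda>x. x)"
  by (cases k) (auto intro: Ck_on_const)

lemma Ck_on_add:
  assumes "open S" "Ck_on k S f" "Ck_on k S g"
  shows "Ck_on k S (\<lambda>x. f x + g x)"
  using assms(2,3)
proof (induction k arbitrary: f g)
  case 0
  then show ?case by (auto intro: continuous_intros)
next
  case (Suc k)
  show ?case
  proof (rule Ck_on_SucI[OF assms(1)])
    show "((\<lambda>x. f x + g x) has_derivative
        (\<lambda>v. frechet_derivative f (at x) v + frechet_derivative g (at x) v)) (at x)"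
      if "x \<in> S" for x
      using Suc.prems that by (auto simp: frechet_derivative_works intro: has_derivative_add)
  qed (use Suc in auto)
qed

lemma Ck_on_sum:
  assumes "open S" "\<And>i. i \<in> I \<Longrightarrow> Ck_on k S (f i)"
  shows "Ck_on k S (\<lambda>x. \<Sum>i\<in>I. f i x)"
  using assms(2) by (induction I rule: infinite_finite_induct) (auto intro: Ck_on_const Ck_on_add assms(1))

text \<open>By the product rule the derivative is a sum of two terms of the same bilinear shape,
  with one factor differentiated and the other lowered by \<open>Ck_on_SucD\<close>.\<close>

lemma Ck_on_bounded_bilinear:
  assumes "bounded_bilinear b" "open S" "Ck_on k S f" "Ck_on k S g"
  shows "Ck_on k S (\<lambda>x. b (f x) (g x))"
  using assms(3,4)
proof (induction k arbitrary: f g)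
  case 0
  then show ?case using bounded_bilinear.continuous_on[OF assms(1)] by auto
next
  case (Suc k)
  show ?case
  proof (rule Ck_on_SucI[OF assms(2)])
    show "((\<lambda>x. b (f x) (g x)) has_derivative
        (\<lambda>v. b (f x) (frechet_derivative g (at x) v) + b (frechet_derivative f (at x) v) (g x))) (at x)"
      if "x \<in> S" for x
      using Suc.prems that
      by (intro bounded_bilinear.FDERIV[OF assms(1)]) (auto simp: frechet_derivative_works)
    show "Ck_on k S (\<lambda>x. b (f x) (frechet_derivative g (at x) v) + b (frechet_derivative f (at x) v) (g x))"
      for v
      using Suc.prems Ck_on_SucD[OF Suc.prems(1)] Ck_on_SucD[OF Suc.prems(2)]
      by (intro Ck_on_add assms(2) Suc.IH) auto
  qed
qed

lemma linear_euclidean_expansion: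
  fixes h :: "'a::euclidean_space \<Rightarrow> 'b::real_vector"
  assumes "linear h"
  shows "h v = (\<Sum>i\<in>Basis. (v \<bullet> i) *\<^sub>R h i)"
proof -
  have "h v = h (\<Sum>i\<in>Basis. (v \<bullet> i) *\<^sub>R i)" by (simp add: euclidean_representation)
  then show ?thesis using assms by (simp add: linear_sum linear_scale)
qed

lemma Ck_on_compose:
  fixes f :: "'a::euclidean_space \<Rightarrow> 'b::euclidean_space" and g :: "'b \<Rightarrow> 'c::real_normed_vector"
  assumes "open S" "Ck_on k S f" "Ck_on k T g" "f ` S \<subseteq> T"
  shows "Ck_on k S (\<lambda>x. g (f x))"
  using assms(2,3)
proof (induction k arbitrary: g)
  case 0
  then show ?case using assms(4) by (auto intro: continuous_on_compose2)
next
  case (Suc k)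
  show ?case
  proof (rule Ck_on_SucI[OF assms(1)])
    fix x assume x: "x \<in> S"
    then have 1: "(f has_derivative frechet_derivative f (at x)) (at x)"
      and 2: "(g has_derivative frechet_derivative g (at (f x))) (at (f x))"
      using Suc.prems assms(4) by (auto simp: frechet_derivative_works[symmetric])
    \<comment> \<open>In the chain rule both the base point and the direction of the derivative of
      \<open>g\<close> vary with \<open>x\<close>. Expanding the direction in the basis leaves
      products of a scalar and a partial derivative of \<open>g\<close> composed with
      \<open>f\<close>, to which the induction hypothesis applies.\<close>
    show "((\<lambda>x. g (f x)) has_derivative
       (\<lambda>v. \<Sum>i\<in>Basis. (frechet_derivative f (at x) v \<bullet> i) *\<^sub>R frechet_derivative g (at (f x)) i)) (at x)"
      by (rule has_derivative_eq_rhs[OF has_derivative_compose[OF 1 2] ext])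
        (rule linear_euclidean_expansion[OF has_derivative_linear[OF 2]])
  next
    fix v
    show "Ck_on k S (\<lambda>x. \<Sum>i\<in>Basis.
        (frechet_derivative f (at x) v \<bullet> i) *\<^sub>R frechet_derivative g (at (f x)) i)"
    proof (intro Ck_on_sum Ck_on_bounded_bilinear[OF bounded_bilinear_scaleR] assms(1))
      fix i :: 'b
      show "Ck_on k S (\<lambda>x. frechet_derivative f (at x) v \<bullet> i)"
        using Suc.prems by (intro Ck_on_bounded_linear[OF bounded_linear_inner_left] assms(1)) auto
      show "Ck_on k S (\<lambda>x. frechet_derivative g (at (f x)) i)"
        using Suc.prems Ck_on_SucD by (intro Suc.IH) auto
    qed
  qed
qed

text \<open>This family is closed under differentiation, so all its members are smooth at once.\<close>

definition flat_exp :: "real poly \<Rightarrow> real \<Rightarrow> real" where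
  "flat_exp P t = (if 0 < t then poly P (1/t) * exp (- (1/t)) else 0)"

lemma poly_times_exp_minus_at_top: "((\<lambda>x::real. poly P x * exp (- x)) \<longlongrightarrow> 0) at_top"
proof -
  have "((\<lambda>x::real. \<Sum>i\<le>degree P. coeff P i * (x ^ i / exp x)) \<longlongrightarrow> (\<Sum>i\<le>degree P. coeff P i * 0)) at_top"
    by (intro tendsto_intros tendsto_power_div_exp_0)
  then show ?thesis
    by (simp add: poly_altdef sum_distrib_right exp_minus divide_inverse mult.assoc)
qed

text \<open>With \<open>s = 1/t\<close> one has \<open>ds/dt = - s^2\<close>, so differentiating
  \<open>P(s) exp(-s)\<close> gives \<open>s^2 (P(s) - P'(s)) exp(-s)\<close>. At the origin
  exponential decay beats every polynomial in \<open>s\<close>.\<close>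

lemma flat_exp_has_derivative:
  "(flat_exp P has_real_derivative flat_exp ([:0, 0, 1:] * (P - pderiv P)) t) (at t)"
proof -
  consider "t > 0" | "t < 0" | "t = 0" by linarith
  then show ?thesis
  proof cases
    case 1
    have "((\<lambda>t. poly P (1/t) * exp (- (1/t))) has_real_derivative
        flat_exp ([:0, 0, 1:] * (P - pderiv P)) t) (at t)"
      using 1 by (auto intro!: derivative_eq_intros DERIV_chain'[OF _ poly_DERIV]
          simp: flat_exp_def power2_eq_square field_simps)
    then show ?thesis
      by (rule has_field_derivative_transform_within_open[where S = "{0<..}"])
        (use 1 in \<open>auto simp: flat_exp_def\<close>)
  next
    case 2
    have "((\<lambda>t. 0) has_real_derivative flat_exp ([:0, 0, 1:] * (P - pderiv P)) t) (at t)"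
      using 2 by (simp add: flat_exp_def)
    then show ?thesis
      by (rule has_field_derivative_transform_within_open[where S = "{..<0}"])
        (use 2 in \<open>auto simp: flat_exp_def\<close>)
  next
    case 3
    have "((\<lambda>h. flat_exp P h / h) \<longlongrightarrow> 0) (at_right 0)"
    proof -
      \<comment> \<open>The factor \<open>[:0, 1:]\<close> absorbs the division by \<open>h\<close>
        in the difference quotient.\<close>
      have "((\<lambda>h. poly ([:0, 1:] * P) (inverse h) * exp (- inverse h)) \<longlongrightarrow> 0) (at_right 0)"
        by (rule filterlim_compose[OF poly_times_exp_minus_at_top filterlim_inverse_at_top_right])
      then show ?thesis
        by (rule Lim_transform_eventually)
          (auto simp: flat_exp_def eventually_at_right_less divide_inverse ac_simps
             intro!: eventually_mono[OF eventually_at_right_less])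
    qed
    moreover have "((\<lambda>h. flat_exp P h / h) \<longlongrightarrow> 0) (at_left 0)"
      by (rule Lim_transform_eventually[where f = "\<lambda>_. 0"])
        (auto simp: flat_exp_def eventually_at_filter)
    ultimately show ?thesis
      using 3 by (simp add: has_field_derivative_iff flat_exp_def filterlim_at_split)
  qed
qed

lemma Ck_on_flat_exp: "Ck_on k UNIV (flat_exp P)"
proof (induction k arbitrary: P)
  case 0
  then show ?case
    by (auto intro!: continuous_at_imp_continuous_on DERIV_isCont flat_exp_has_derivative)
next
  case (Suc k)
  show ?case
  proof (rule Ck_on_SucI)
    show "(flat_exp P has_derivative (*) (flat_exp ([:0, 0, 1:] * (P - pderiv P)) t)) (at t)" for t
      using flat_exp_has_derivative unfolding has_field_derivative_def .
    show "Ck_on k UNIV (\<lambda>t. flat_exp ([:0, 0, 1:] * (P - pderiv P)) t * v)" for v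
      by (rule Ck_on_bounded_linear[OF bounded_linear_mult_left _ Suc.IH]) simp
  qed simp
qed

lemma smooth_bump_exists:
  fixes a :: "'a::euclidean_space"
  assumes "0 < r"
  obtains b :: "'a \<Rightarrow> real" where "smooth_on UNIV b" "b a = 1" "\<And>u. u \<notin> cball a r \<Longrightarrow> b u = 0"
proof
  \<comment> \<open>The squared distance keeps \<open>q\<close> smooth at the centre
    \<open>a\<close>. It is negative outside the ball, where \<open>flat_exp\<close> vanishes by
    definition; dividing by \<open>?c\<close> normalizes the value at \<open>a\<close>.\<close>
  define q where "q u = r\<^sup>2 - (u - a) \<bullet> (u - a)" for u
  let ?c = "flat_exp 1 (r\<^sup>2)"
  have sub: "Ck_on k UNIV (\<lambda>u. u - a)" for k
    using Ck_on_add[OF open_UNIV Ck_on_ident Ck_on_const, of k "- a"] by simp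
  have "Ck_on k UNIV (\<lambda>u. (u - a) \<bullet> (u - a))" for k
    by (intro Ck_on_bounded_bilinear[OF bounded_bilinear_inner] sub) simp
  then have "Ck_on k UNIV (\<lambda>u. - ((u - a) \<bullet> (u - a)))" for k
    by (rule Ck_on_bounded_linear[OF bounded_linear_minus[OF bounded_linear_ident], rotated]) simp
  then have "Ck_on k UNIV q" for k
    unfolding q_def diff_conv_add_uminus by (intro Ck_on_add Ck_on_const) simp
  then have "Ck_on k UNIV (\<lambda>u. flat_exp 1 (q u))" for k
    by (intro Ck_on_compose[OF _ _ Ck_on_flat_exp]) auto
  then show "smooth_on UNIV (\<lambda>u. flat_exp 1 (q u) / ?c)"
    unfolding smooth_on_def by (intro allI Ck_on_bounded_linear[OF bounded_linear_divide]) simp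
  show "flat_exp 1 (q a) / ?c = 1"
    using assms by (simp add: q_def flat_exp_def)
  show "flat_exp 1 (q u) / ?c = 0" if "u \<notin> cball a r" for u
  proof -
    have "r < norm (u - a)" using that by (simp add: dist_norm norm_minus_commute)
    then have "r\<^sup>2 \<le> (norm (u - a))\<^sup>2" using assms by (intro power_mono) auto
    then show ?thesis by (simp add: q_def flat_exp_def power2_norm_eq_inner)
  qed
qed

subsection \<open>Smooth vector fields with a prescribed value\<close>

context
  fixes A :: "('a::{t2_space,second_countable_topology}) chart set"
  assumes atlas: "oriented_smooth_atlas A"
begin

lemma chart_at: "chart_at A p \<in> A" "p \<in> chart_dom (chart_at A p)"
proof -
  have "p \<in> (\<Union>K\<in>A. chart_dom K)" using atlas by (simp add: oriented_smooth_atlas_def)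
  then have "\<exists>K. K \<in> A \<and> p \<in> chart_dom K" by blast
  then have "chart_at A p \<in> A \<and> p \<in> chart_dom (chart_at A p)"
    unfolding chart_at_def by (rule someI_ex)
  then show "chart_at A p \<in> A" "p \<in> chart_dom (chart_at A p)" by auto
qed

lemma chart:
  assumes "K \<in> A"
  shows "open (chart_dom K)" "open (chart_img K)"
    "homeomorphism (chart_dom K) (chart_img K) (chart_map K) (chart_inv K)"
  using atlas assms by (auto simp: oriented_smooth_atlas_def)

lemma chart_inv_map [simp]: "K \<in> A \<Longrightarrow> q \<in> chart_dom K \<Longrightarrow> chart_inv K (chart_map K q) = q"
  using chart(3) by (auto simp: homeomorphism_def)

lemma open_chart_map_image:
  assumes "K \<in> A" "open U"
  shows "open (chart_map K ` (chart_dom K \<inter> U))"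
  using homeomorphism_imp_open_map[OF chart(3)[OF assms(1)], of "chart_dom K \<inter> U"]
    assms chart(2)[OF assms(1)] by (auto simp: openin_open_eq intro: openin_open_Int)

lemma transition_Ck_on:
  assumes "K \<in> A" "L \<in> A"
  shows "Ck_on k (chart_map K ` (chart_dom K \<inter> chart_dom L)) (chart_map L \<circ> chart_inv K)"
  using atlas assms by (auto simp: oriented_smooth_atlas_def smooth_on_def)

lemma transition_has_derivative:
  assumes "K \<in> A" "L \<in> A" "p \<in> chart_dom K" "p \<in> chart_dom L"
  shows "((chart_map L \<circ> chart_inv K) has_derivative coord_change K L p) (at (chart_map K p))"
  using transition_Ck_on[OF assms(1,2), of 1] assms(3,4)
  by (auto simp: coord_change_def frechet_derivative_works)

lemma linear_coord_change:
  assumes "K \<in> A" "L \<in> A" "p \<in> chart_dom K" "p \<in> chart_dom L"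
  shows "linear (coord_change K L p)"
  using transition_has_derivative[OF assms] by (rule has_derivative_linear)

lemma coord_change_trans:
  assumes "K \<in> A" "J \<in> A" "L \<in> A" "p \<in> chart_dom K" "p \<in> chart_dom J" "p \<in> chart_dom L"
  shows "coord_change J L p (coord_change K J p v) = coord_change K L p v"
proof -
  let ?U = "chart_map K ` (chart_dom K \<inter> chart_dom J)"
  have "((chart_map J \<circ> chart_inv K) has_derivative coord_change K J p) (at (chart_map K p))"
    using assms by (intro transition_has_derivative)
  moreover have "((chart_map L \<circ> chart_inv J) has_derivative coord_change J L p)
      (at ((chart_map J \<circ> chart_inv K) (chart_map K p)))"
    using assms transition_has_derivative[of J L p] by simp
  ultimately have "((chart_map L \<circ> chart_inv J) \<circ> (chart_map J \<circ> chart_inv K)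
      has_derivative coord_change J L p \<circ> coord_change K J p) (at (chart_map K p))"
    by (rule diff_chain_at)
  \<comment> \<open>The maps of \<open>J\<close> cancel only where \<open>K\<close> and
    \<open>J\<close> overlap, which is an open neighbourhood and hence enough for the
    derivative.\<close>
  then have "((chart_map L \<circ> chart_inv K)
      has_derivative coord_change J L p \<circ> coord_change K J p) (at (chart_map K p))"
    by (rule has_derivative_transform_within_open[where s = ?U])
      (use assms in \<open>auto intro: open_chart_map_image chart(1)\<close>)
  then have "coord_change J L p \<circ> coord_change K J p = coord_change K L p"
    by (rule has_derivative_unique) (use assms in \<open>intro transition_has_derivative\<close>)
  then show ?thesis by (metis comp_apply)
qed

lemma coord_change_self:
  assumes "K \<in> A" "p \<in> chart_dom K"
  shows "coord_change K K p v = v"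
proof -
  have "((\<lambda>u. u) has_derivative (\<lambda>v. v)) (at (chart_map K p))" by (rule has_derivative_ident)
  then have "((chart_map K \<circ> chart_inv K) has_derivative (\<lambda>v. v)) (at (chart_map K p))"
    by (rule has_derivative_transform_within_open[where s = "chart_img K"])
      (use assms chart[OF assms(1)] in \<open>auto simp: chart_img_def\<close>)
  then have "coord_change K K p = (\<lambda>v. v)"
    by (rule has_derivative_unique[OF transition_has_derivative[OF assms(1,1,2,2)]])
  then show ?thesis by simp
qed

text \<open>The bridge from identities between fields to identities between tangent vectors: the
  field with constant coordinates \<open>v\<close> in one chart is multiplied by a bump function and
  extended by zero.\<close>

lemma smooth_vfield_extension:
  obtains X where "smooth_vfield A X" "X p = v"
proof -
  define K where "K = chart_at A p"
  have K: "K \<in> A" "p \<in> chart_dom K" unfolding K_def by (rule chart_at)+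
  obtain r where r: "0 < r" "cball (chart_map K p) r \<subseteq> chart_img K"
    using chart(2)[OF K(1)] K(2) by (metis open_contains_cball chart_img_def imageI)
  obtain b where b: "smooth_on UNIV b" "b (chart_map K p) = (1::real)"
      "\<And>u. u \<notin> cball (chart_map K p) r \<Longrightarrow> b u = 0"
    by (rule smooth_bump_exists[OF r(1), of "chart_map K p"]) (rule that)
  define C where "C = chart_inv K ` cball (chart_map K p) r"
  have "continuous_on (cball (chart_map K p) r) (chart_inv K)"
    using chart(3)[OF K(1)] r(2) by (auto simp: homeomorphism_def intro: continuous_on_subset)
  then have "compact C" unfolding C_def by (rule compact_continuous_image) (rule compact_cball)
  \<comment> \<open>The Hausdorff property enters here: without it the extension by zero could fail
    to be smooth at points outside the chart.\<close>
  then have C: "closed C" by (rule compact_imp_closed)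
  \<comment> \<open>A field stores its value at \<open>q\<close> in the coordinates of
    \<open>chart_at A q\<close>, hence the coordinate change from \<open>K\<close>.\<close>
  define X where "X q = (if q \<in> chart_dom K
      then b (chart_map K q) *\<^sub>R coord_change K (chart_at A q) q v else 0)" for q
  have "Ck_on k (chart_img L) (local_rep A L X)" if L: "L \<in> A" for L k
  proof -
    \<comment> \<open>Smoothness in \<open>L\<close> is glued from two open pieces: the overlap with
      \<open>K\<close>, and the complement of \<open>C\<close>, on which the field is zero. They
      cover the image of \<open>L\<close> because \<open>C\<close> lies in the domain of
      \<open>K\<close>.\<close>
    define U where "U = chart_map L ` (chart_dom L \<inter> chart_dom K)"
    define V where "V = chart_map L ` (chart_dom L \<inter> - C)"
    have open_U: "open U" and open_V: "open V"
      unfolding U_def V_def using C L chart(1)[OF K(1)]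
      by (simp_all add: open_chart_map_image open_Compl)
    have C_dom: "C \<subseteq> chart_dom K"
      using r(2) K(1) by (auto simp: C_def chart_img_def dest!: subsetD)
    \<comment> \<open>The arbitrary chart \<open>chart_at A q\<close> drops out by the cocycle rule
      \<open>coord_change_trans\<close>.\<close>
    have rep: "local_rep A L X (chart_map L q) = (if q \<in> chart_dom K
        then b (chart_map K q) *\<^sub>R coord_change K L q v else 0)" if "q \<in> chart_dom L" for q
      using that L K chart_at[of q]
        linear_scale[OF linear_coord_change[OF chart_at(1) L chart_at(2), of q]]
        linear_0[OF linear_coord_change[OF chart_at(1) L chart_at(2), of q]]
      by (simp add: local_rep_def X_def coord_change_trans Let_def)
    have trans: "Ck_on k U (chart_map K \<circ> chart_inv L)" for k
      unfolding U_def using L K(1) by (rule transition_Ck_on)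
    have "Ck_on k U (\<lambda>u. b ((chart_map K \<circ> chart_inv L) u))"
      using b(1) by (intro Ck_on_compose[OF open_U trans]) (auto simp: smooth_on_def)
    moreover have "Ck_on k U (\<lambda>u. frechet_derivative (chart_map L \<circ> chart_inv K)
        (at ((chart_map K \<circ> chart_inv L) u)) v)"
    proof (rule Ck_on_compose[OF open_U trans])
      show "Ck_on k (chart_map K ` (chart_dom K \<inter> chart_dom L))
          (\<lambda>a. frechet_derivative (chart_map L \<circ> chart_inv K) (at a) v)"
        using transition_Ck_on[OF K(1) L, of "Suc k"] by simp
      show "(chart_map K \<circ> chart_inv L) ` U \<subseteq> chart_map K ` (chart_dom K \<inter> chart_dom L)"
        using L by (auto simp: U_def)
    qed
    ultimately have "Ck_on k U (\<lambda>u. b ((chart_map K \<circ> chart_inv L) u) *\<^sub>R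
        frechet_derivative (chart_map L \<circ> chart_inv K) (at ((chart_map K \<circ> chart_inv L) u)) v)"
      by (rule Ck_on_bounded_bilinear[OF bounded_bilinear_scaleR open_U])
    then have "Ck_on k U (local_rep A L X)"
      by (rule Ck_on_cong[OF open_U, rotated]) (use L in \<open>auto simp: U_def rep coord_change_def\<close>)
    moreover have "local_rep A L X u = 0" if u: "u \<in> V" for u
    proof -
      obtain q where q: "u = chart_map L q" "q \<in> chart_dom L" "q \<notin> C"
        using u by (auto simp: V_def)
      have "b (chart_map K q) = 0" if "q \<in> chart_dom K"
      proof (rule b(3))
        show "chart_map K q \<notin> cball (chart_map K p) r"
          using q(3) chart_inv_map[OF K(1) that] unfolding C_def by (metis imageI)
      qed
      then show ?thesis by (simp add: q rep)
    qed
    then have "Ck_on k V (local_rep A L X)"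
      by (intro Ck_on_cong[OF open_V _ Ck_on_const[of k V 0]]) simp
    moreover have "chart_img L = U \<union> V"
      using C_dom by (auto simp: chart_img_def U_def V_def)
    ultimately show ?thesis
      using Ck_on_Un[OF open_U open_V] by simp
  qed
  then have "smooth_vfield A X" by (simp add: smooth_vfield_def smooth_on_def)
  moreover have "X p = v"
    using K coord_change_self[OF K, of v] b(2) by (simp add: X_def K_def[symmetric])
  ultimately show ?thesis using that by blast
qed

end

subsection \<open>The cross product\<close>

lemma exhaust_7:
  fixes x :: 7
  shows "x = 1 \<or> x = 2 \<or> x = 3 \<or> x = 4 \<or> x = 5 \<or> x = 6 \<or> x = 7"
proof (induct x)
  case (of_int z)
  then have "0 \<le> z" and "z < 7" by simp_all
  \<comment> \<open>The residue \<open>0\<close> is the index \<open>7\<close>.\<close>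
  then have "z = 0 \<or> z = 1 \<or> z = 2 \<or> z = 3 \<or> z = 4 \<or> z = 5 \<or> z = 6" by arith
  then show ?case by auto
qed

lemma forall_7: "(\<forall>i::7. P i) \<longleftrightarrow> P 1 \<and> P 2 \<and> P 3 \<and> P 4 \<and> P 5 \<and> P 6 \<and> P 7"
  by (metis exhaust_7)

text \<open>The component \<open>i\<close> is the coefficient of \<open>z $ i\<close> in
  \<open>phi0 x y z\<close>, with the sign flipped for the four negative directions of
  \<open>g0\<close>. The last branch is the index \<open>7\<close>.\<close>

definition cross0 :: "real^7 \<Rightarrow> real^7 \<Rightarrow> real^7" where
  "cross0 x y = (\<chi> i.
     if i = 1 then (x$2 * y$7 - x$7 * y$2) + (x$3 * y$5 - x$5 * y$3) - (x$4 * y$6 - x$6 * y$4)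
     else if i = 2 then (x$7 * y$1 - x$1 * y$7) - (x$3 * y$6 - x$6 * y$3) - (x$4 * y$5 - x$5 * y$4)
     else if i = 3 then (x$5 * y$1 - x$1 * y$5) - (x$6 * y$2 - x$2 * y$6) + (x$4 * y$7 - x$7 * y$4)
     else if i = 4 then (x$1 * y$6 - x$6 * y$1) - (x$5 * y$2 - x$2 * y$5) + (x$7 * y$3 - x$3 * y$7)
     else if i = 5 then (x$3 * y$1 - x$1 * y$3) + (x$2 * y$4 - x$4 * y$2) + (x$6 * y$7 - x$7 * y$6)
     else if i = 6 then (x$1 * y$4 - x$4 * y$1) + (x$2 * y$3 - x$3 * y$2) + (x$7 * y$5 - x$5 * y$7)
     else (x$2 * y$1 - x$1 * y$2) - (x$3 * y$4 - x$4 * y$3) + (x$5 * y$6 - x$6 * y$5))"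

lemma cross0_nth:
  "cross0 x y $ 1 = (x$2 * y$7 - x$7 * y$2) + (x$3 * y$5 - x$5 * y$3) - (x$4 * y$6 - x$6 * y$4)"
  "cross0 x y $ 2 = (x$7 * y$1 - x$1 * y$7) - (x$3 * y$6 - x$6 * y$3) - (x$4 * y$5 - x$5 * y$4)"
  "cross0 x y $ 3 = (x$5 * y$1 - x$1 * y$5) - (x$6 * y$2 - x$2 * y$6) + (x$4 * y$7 - x$7 * y$4)"
  "cross0 x y $ 4 = (x$1 * y$6 - x$6 * y$1) - (x$5 * y$2 - x$2 * y$5) + (x$7 * y$3 - x$3 * y$7)"
  "cross0 x y $ 5 = (x$3 * y$1 - x$1 * y$3) + (x$2 * y$4 - x$4 * y$2) + (x$6 * y$7 - x$7 * y$6)"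
  "cross0 x y $ 6 = (x$1 * y$4 - x$4 * y$1) + (x$2 * y$3 - x$3 * y$2) + (x$7 * y$5 - x$5 * y$7)"
  "cross0 x y $ 7 = (x$2 * y$1 - x$1 * y$2) - (x$3 * y$4 - x$4 * y$3) + (x$5 * y$6 - x$6 * y$5)"
  by (simp_all add: cross0_def)

lemma phi0_eq_g0_cross0: "phi0 x y z = g0 (cross0 x y) z"
  by (simp add: phi0_def wedge3_def g0_def cross0_nth det_3 algebra_simps)

text \<open>The double cross product identity of the imaginary split octonions, checked by expanding
  coordinates. For a vector of square \<open>-1\<close> it becomes \<phi>^2 = I - \<eta> \<otimes>
  \<xi>.\<close>

lemma cross0_cross0: "cross0 x (cross0 x y) = g0 x y *\<^sub>R x - g0 x x *\<^sub>R y"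
  by (simp add: vec_eq_iff forall_7 cross0_nth g0_def algebra_simps)

lemma g0_nondegenerate:
  assumes "\<And>z. g0 x z = 0"
  shows "x = 0"
proof -
  have "x $ i = 0" for i
    using assms[of "axis i 1"] exhaust_7[of i] by (auto simp: g0_def axis_def)
  then show ?thesis by (simp add: vec_eq_iff)
qed

lemma linear_g0: "linear (g0 x)" "linear (\<lambda>x. g0 x y)"
  by (auto intro!: linearI simp: g0_def algebra_simps)

lemma g0_commute: "g0 x y = g0 y x"
  by (simp add: g0_def)

section \<open>Transport of the metric and the cross product to a tangent space\<close>

text \<open>Names the very choice made inside \<open>g43\<close>, so that the metric is a pullback
  of \<open>g0\<close> by definition.\<close>

definition frame :: "form3 \<Rightarrow> real^7 \<Rightarrow> real^7" where
  "frame w = (SOME T. g2_star_iso w T)"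

lemma g43_frame: "g43 w x y = g0 (frame w x) (frame w y)"
  by (simp add: g43_def frame_def Let_def)

lemma g43_commute: "g43 w x y = g43 w y x"
  by (simp add: g43_frame g0_commute)

context
  fixes w :: form3
  assumes alternating: "alternating_3form w"
    and iso_ex: "\<exists>T. g2_star_iso w T"
begin

lemma frame: "linear (frame w)" "bij (frame w)" "w x y z = phi0 (frame w x) (frame w y) (frame w z)"
proof -
  have "g2_star_iso w (frame w)" unfolding frame_def by (rule someI_ex[OF iso_ex])
  then show "linear (frame w)" "bij (frame w)" "w x y z = phi0 (frame w x) (frame w y) (frame w z)"
    by (auto simp only: g2_star_iso_def)
qed

lemma linear_g43_right: "linear (g43 w x)"
  using linear_compose[OF frame(1) linear_g0(1)[of "frame w x"]] by (simp add: g43_frame[abs_def] o_def)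

lemma linear_g43_left: "linear (\<lambda>x. g43 w x y)"
  using linear_g43_right[of y] by (simp add: g43_commute[of _ _ y])

lemmas g43_simps =
  linear_add[OF linear_g43_left] linear_add[OF linear_g43_right]
  linear_diff[OF linear_g43_left] linear_diff[OF linear_g43_right]
  linear_scale[OF linear_g43_left] linear_scale[OF linear_g43_right]
  linear_neg[OF linear_g43_left] linear_neg[OF linear_g43_right]
  linear_0[OF linear_g43_left] linear_0[OF linear_g43_right]

lemma g43_nondegenerate:
  assumes "\<And>z. g43 w x z = 0"
  shows "x = 0"
proof -
  have "g0 (frame w x) z = 0" for z
    using assms[of "inv (frame w) z"] frame(2) by (simp add: g43_frame bij_is_surj surj_f_inv_f)
  then have "frame w x = frame w 0" using g0_nondegenerate linear_0[OF frame(1)] by metis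
  then show ?thesis using frame(2) by (simp add: bij_is_inj inj_eq)
qed

lemma g43_eqI:
  assumes "\<And>z. g43 w x z = g43 w y z"
  shows "x = y"
  using g43_nondegenerate[of "x - y"] assms by (simp add: g43_simps)

text \<open>Existence comes from pulling back \<open>cross0\<close>; uniqueness, needed for the
  definite description, from nondegeneracy.\<close>

lemma cross_prod_frame: "cross_prod w x y = inv (frame w) (cross0 (frame w x) (frame w y))"
  unfolding cross_prod_def
proof (rule the_equality)
  show *: "\<forall>z. w x y z = g43 w (inv (frame w) (cross0 (frame w x) (frame w y))) z"
    using frame(2) by (simp add: g43_frame frame(3) phi0_eq_g0_cross0 bij_is_surj surj_f_inv_f)
  show "v = inv (frame w) (cross0 (frame w x) (frame w y))" if "\<forall>z. w x y z = g43 w v z" for v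
    using that * by (intro g43_eqI) simp
qed

lemma g43_cross_prod: "g43 w (cross_prod w x y) z = w x y z"
  using frame(2)
  by (simp add: g43_frame cross_prod_frame frame(3) phi0_eq_g0_cross0 bij_is_surj surj_f_inv_f)

lemma cross_prod_cross_prod:
  "cross_prod w x (cross_prod w x y) = g43 w x y *\<^sub>R x - g43 w x x *\<^sub>R y"
proof -
  have "frame w (cross_prod w x (cross_prod w x y)) = frame w (g43 w x y *\<^sub>R x - g43 w x x *\<^sub>R y)"
    using frame(2) by (simp add: cross_prod_frame bij_is_surj surj_f_inv_f cross0_cross0 g43_frame
        linear_diff[OF frame(1)] linear_scale[OF frame(1)])
  then show ?thesis using frame(2) by (simp add: bij_is_inj inj_eq)
qed

lemma alternating_simps: "w x x y = 0" "w x y x = 0" "w y x x = 0"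
  using alternating by (auto simp: alternating_3form_def)

text \<open>Polarization of the vanishing on equal arguments: expand
  \<open>w (x + y) (x + y) z = 0\<close>.\<close>

lemma form_swap_12: "w x y z = - w y x z"
proof -
  have l: "linear (\<lambda>x. w x y z)" "linear (\<lambda>y. w x y z)" for x y z
    using alternating by (auto simp: alternating_3form_def)
  have "w (x + y) (x + y) z = w x x z + w y x z + (w x y z + w y y z)"
    by (simp only: linear_add[OF l(1)] linear_add[OF l(2)] ac_simps)
  then show ?thesis unfolding alternating_simps by linarith
qed

lemma form_swap_23: "w x y z = - w x z y"
proof -
  have l: "linear (\<lambda>z. w x y z)" "linear (\<lambda>y. w x y z)" for x y z
    using alternating by (auto simp: alternating_3form_def)
  have "w x (y + z) (y + z) = w x y y + w x z y + (w x y z + w x z z)"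
    by (simp only: linear_add[OF l(1)] linear_add[OF l(2)] ac_simps)
  then show ?thesis unfolding alternating_simps by linarith
qed

lemma cross_prod_commute: "cross_prod w x y = - cross_prod w y x"
  by (rule g43_eqI) (simp add: g43_simps g43_cross_prod form_swap_12[of x y])

lemma linear_cross_prod: "linear (cross_prod w x)"
proof -
  have l: "linear (\<lambda>y. w x y z)" for z
    using alternating by (auto simp: alternating_3form_def)
  show ?thesis
    by (intro linearI g43_eqI) (simp_all add: g43_simps g43_cross_prod linear_add[OF l] linear_scale[OF l])
qed

lemma g43_cross_prod_skew: "g43 w (cross_prod w x y) z = - g43 w y (cross_prod w x z)"
  by (simp add: g43_cross_prod g43_commute[of _ y] form_swap_23[of x y])

lemma cross_prod_self: "cross_prod w x x = 0"
  by (rule g43_nondegenerate) (simp add: g43_cross_prod alternating_simps)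

text \<open>The algebraic core, with \<open>B\<close> standing for the map sending \<open>x\<close>
  to \<nabla>_x \<xi>. \<open>S\<close> is the brace in \<open>F9\<close> after writing F(X, Y,
  \<xi>) as \<open>g43 w (f Y) (B X)\<close>. The signs on the left, and the minus in
  \<open>-2\<close>, reflect g = - \<open>g43\<close>.\<close>

lemma F9_pointwise:
  fixes \<xi> :: "real^7" and B :: "real^7 \<Rightarrow> real^7"
  defines "f \<equiv> cross_prod w \<xi>"
  defines "S \<equiv> \<lambda>x z. g43 w (f (f (f z))) (B (f (f x))) + g43 w (f (f z)) (B (f x))
      - g43 w (f (f (f x))) (B (f (f z))) - g43 w (f (f x)) (B (f z))"
  assumes unit: "g43 w \<xi> \<xi> = -1" and lin: "linear B"
    and skew: "\<And>x y. g43 w (B x) y = - g43 w (B y) x" and orth: "\<And>x. g43 w (B x) \<xi> = 0"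
  shows "g43 w (- g43 w \<xi> y *\<^sub>R (cross_prod w (B x) \<xi> + B (f x)) + (g43 w (B (f x)) y - g43 w (B (f y)) x) *\<^sub>R \<xi>) z
    = -2 * (1/4 * g43 w \<xi> y * S x z - 1/4 * g43 w \<xi> z * S x y)"
proof -
  have ff: "f (f x) = x + g43 w \<xi> x *\<^sub>R \<xi>" for x
    using unit by (simp add: f_def cross_prod_cross_prod)
  have f_xi: "f \<xi> = 0" by (simp add: f_def cross_prod_self)
  \<comment> \<open>Skewness turns the pairing of \<open>B \<xi>\<close> with \<open>z\<close> into
    that of \<open>B z\<close> with \<open>\<xi>\<close>, which vanishes by
    \<open>orth\<close>.\<close>
  have B_xi: "B \<xi> = 0"
    by (rule g43_nondegenerate) (simp add: skew[of \<xi>] orth)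
  have fff: "f (f (f x)) = f x" for x
  proof -
    have "f (x + g43 w \<xi> x *\<^sub>R \<xi>) = f x"
      using f_xi linear_cross_prod[of \<xi>] by (simp add: f_def linear_add linear_scale)
    then show ?thesis by (simp add: ff)
  qed
  have Bff: "B (f (f x)) = B x" for x
    by (simp add: ff linear_add[OF lin] linear_scale[OF lin] B_xi)
  \<comment> \<open>\<open>orth\<close> removes the \<open>\<xi>\<close> components produced by
    \<open>f (f _)\<close>. By skewness of \<open>B\<close> the last two terms then repeat the first
    two, whence the factor 2.\<close>
  have S: "S x z = 2 * (g43 w (B x) (f z) + g43 w (B (f x)) z)" for x z
  proof -
    have "S x z = g43 w (B x) (f z) + g43 w (B (f x)) z - g43 w (B z) (f x) - g43 w (B (f z)) x"
      unfolding S_def fff Bff unfolding ff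
      by (simp add: g43_simps orth g43_commute[of _ _ "B _"] g43_commute[of _ \<xi>])
    then show ?thesis using skew[of z "f x"] skew[of "f z" x] by simp
  qed
  \<comment> \<open>Swapping the factors and moving \<open>f\<close> across the metric each cost a
    sign, and the two cancel.\<close>
  have "g43 w (cross_prod w (B x) \<xi>) z = g43 w (B x) (f z)" for z
    using cross_prod_commute[of "B x" \<xi>] g43_cross_prod_skew[of \<xi> "B x" z]
    by (simp add: f_def g43_simps)
  \<comment> \<open>This turns the coefficient of \<open>\<xi>\<close> into half of
    \<open>S x y\<close>.\<close>
  moreover have "g43 w (B (f y)) x = - g43 w (B x) (f y)" by (rule skew)
  ultimately show ?thesis by (simp add: S g43_simps algebra_simps)
qed

end

section \<open>From tangent spaces to fields on the manifold\<close>

lemma g2_star_structure_form: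
  assumes "g2_star_structure A \<phi>"
  shows "alternating_3form (\<phi> p)" "\<exists>T. g2_star_iso (\<phi> p) T"
  using assms by (auto simp: g2_star_structure_def smooth_3form_def)

text \<open>The form is alternating, so \<Phi>(Y, \<xi>) = 0 and only - \<Phi>(Y, \<nabla>_X \<xi>)
  survives; its sign is absorbed by g = - \<open>g43\<close>. \<open>X\<close> and \<open>Y\<close>
  are arbitrary functions, so fields such as \<open>pc_phi \<phi> \<xi> X\<close> can be inserted
  directly.\<close>

lemma F_tensor_xi:
  assumes "g2_star_structure A \<phi>"
  shows "F_tensor A \<phi> \<xi> nabla X Y \<xi> p
    = g43 (\<phi> p) (cross_prod (\<phi> p) (\<xi> p) (Y p)) (nabla \<xi> p (X p))"
proof -
  note form = g2_star_structure_form[OF assms]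
  have "fund_form \<phi> \<xi> Y \<xi> q = 0" for Y q
    by (simp add: fund_form_def pc_metric_def pc_phi_def g43_cross_prod[OF form]
        alternating_simps[OF form])
  then have 0: "fund_form \<phi> \<xi> Y \<xi> = (\<lambda>q. 0)" for Y by (rule ext)
  show ?thesis
    unfolding F_tensor_def 0
    by (simp add: dir_deriv_def o_def fund_form_def pc_metric_def pc_phi_def cov_def)
qed

text \<open>The Killing condition speaks of smooth fields; extending \<open>x\<close> and
  \<open>y\<close> to such fields makes it pointwise.\<close>

lemma killing_nabla_skew:
  assumes "oriented_smooth_atlas A" "killing A \<phi> nabla \<xi>"
  shows "g43 (\<phi> p) (nabla \<xi> p x) y = - g43 (\<phi> p) (nabla \<xi> p y) x"
proof -
  obtain X where X: "smooth_vfield A X" "X p = x" by (rule smooth_vfield_extension[OF assms(1)])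
  obtain Y where Y: "smooth_vfield A Y" "Y p = y" by (rule smooth_vfield_extension[OF assms(1)])
  have "pc_metric \<phi> p (cov nabla X \<xi> p) (Y p) = - pc_metric \<phi> p (cov nabla Y \<xi> p) (X p)"
    using assms(2) X(1) Y(1) unfolding killing_def by blast
  then show ?thesis by (simp add: pc_metric_def cov_def X Y)
qed

text \<open>Metric compatibility equates the derivative of the constant g(\<xi>, \<xi>) with twice
  the pairing of \<nabla>_X \<xi> and \<xi>.\<close>

lemma nabla_orthogonal_constant_length:
  assumes "oriented_smooth_atlas A" "levi_civita A (\<lambda>p. g43 (\<phi> p)) nabla"
    and "smooth_vfield A \<xi>" "\<And>q. g43 (\<phi> q) (\<xi> q) (\<xi> q) = c"
  shows "g43 (\<phi> p) (nabla \<xi> p x) (\<xi> p) = 0"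
proof -
  obtain X where X: "smooth_vfield A X" "X p = x" by (rule smooth_vfield_extension[OF assms(1)])
  have "dir_deriv A p (X p) (\<lambda>q. g43 (\<phi> q) (\<xi> q) (\<xi> q))
      = g43 (\<phi> p) (cov nabla X \<xi> p) (\<xi> p) + g43 (\<phi> p) (\<xi> p) (cov nabla X \<xi> p)"
    using assms(2,3) X(1) unfolding levi_civita_def by blast
  then show ?thesis
    using assms(4) by (simp add: dir_deriv_def o_def cov_def X g43_commute[of _ "\<xi> p"])
qed

text \<open>\<open>F9_pointwise\<close> with \<open>B = nabla \<xi> p\<close>. Both directions of
  the theorem are read off from this one identity.\<close>

lemma g43_F9:
  assumes "oriented_smooth_atlas A" "g2_star_structure A \<phi>"
    and "levi_civita A (\<lambda>p. g43 (\<phi> p)) nabla" "smooth_vfield A \<xi>"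
    and "\<And>q. g43 (\<phi> q) (\<xi> q) (\<xi> q) = -1" "killing A \<phi> nabla \<xi>"
  shows "g43 (\<phi> p) (pc_eta \<phi> \<xi> Y p *\<^sub>R
          (cross_prod (\<phi> p) (cov nabla X \<xi> p) (\<xi> p) + cov nabla (pc_phi \<phi> \<xi> X) \<xi> p)
        + (pc_metric \<phi> p (cov nabla (pc_phi \<phi> \<xi> Y) \<xi> p) (X p)
          - pc_metric \<phi> p (cov nabla (pc_phi \<phi> \<xi> X) \<xi> p) (Y p)) *\<^sub>R \<xi> p) (Z p)
    = -2 * F9 A \<phi> \<xi> nabla X Y Z p"
proof -
  have lin: "linear (nabla \<xi> p)"
    using assms(3,4) by (auto simp: levi_civita_def affine_connection_def)
  show ?thesis
    using F9_pointwise[OF g2_star_structure_form[OF assms(2)] assms(5) lin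
        killing_nabla_skew[OF assms(1,6)] nabla_orthogonal_constant_length[OF assms(1,3,4,5)],
        of "Y p" "X p" "Z p"]
    by (simp add: F9_def F_tensor_xi[OF assms(2)] pc_eta_def pc_metric_def pc_phi_def cov_def Let_def)
qed

theorem theorem10:
  fixes A :: "('a::{t2_space,second_countable_topology}) chart set"
    and \<phi> :: "'a \<Rightarrow> form3"
    and \<xi> :: "'a vfield"
    and nabla :: "'a connection"
  assumes "oriented_smooth_atlas A"
    and "g2_star_structure A \<phi>"
    and "levi_civita A (\<lambda>p. g43 (\<phi> p)) nabla"
    and "smooth_vfield A \<xi>"
    and "\<forall>p. g43 (\<phi> p) (\<xi> p) (\<xi> p) = -1"
    and "killing A \<phi> nabla \<xi>"
  shows "(\<forall>X Y Z. smooth_vfield A X \<longrightarrow> smooth_vfield A Y \<longrightarrow> smooth_vfield A Z \<longrightarrow>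
            (\<forall>p. F9 A \<phi> \<xi> nabla X Y Z p = 0))
     \<longleftrightarrow>
         (\<forall>X Y. smooth_vfield A X \<longrightarrow> smooth_vfield A Y \<longrightarrow>
            (\<forall>p. pc_eta \<phi> \<xi> Y p *\<^sub>R
                   (cross_prod (\<phi> p) (cov nabla X \<xi> p) (\<xi> p) + cov nabla (pc_phi \<phi> \<xi> X) \<xi> p)
                 + (pc_metric \<phi> p (cov nabla (pc_phi \<phi> \<xi> Y) \<xi> p) (X p)
                    - pc_metric \<phi> p (cov nabla (pc_phi \<phi> \<xi> X) \<xi> p) (Y p)) *\<^sub>R \<xi> p = 0))"
    (is "?L \<longleftrightarrow> (\<forall>X Y. _ \<longrightarrow> _ \<longrightarrow> (\<forall>p. ?W X Y p = 0))")
proof -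
  note W = g43_F9[OF assms(1-4) assms(5)[rule_format] assms(6)]
  note form = g2_star_structure_form[OF assms(2)]
  show ?thesis
  proof
    assume L: ?L
    show "\<forall>X Y. smooth_vfield A X \<longrightarrow> smooth_vfield A Y \<longrightarrow> (\<forall>p. ?W X Y p = 0)"
    proof (intro allI impI)
      fix X Y p assume XY: "smooth_vfield A X" "smooth_vfield A Y"
      show "?W X Y p = 0"
      \<comment> \<open>Nondegeneracy tests against all tangent vectors at \<open>p\<close>, whereas
        the hypothesis only concerns smooth \<open>Z\<close>; each test vector is therefore extended
        to a field.\<close>
      proof (rule g43_nondegenerate[OF form])
        fix z
        obtain Z where Z: "smooth_vfield A Z" "Z p = z" by (rule smooth_vfield_extension[OF assms(1)])
        have "F9 A \<phi> \<xi> nabla X Y Z p = 0" using L XY Z(1) by blast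
        then show "g43 (\<phi> p) (?W X Y p) z = 0"
          using W[where p = p and X = X and Y = Y and Z = Z] Z(2) by simp
      qed
    qed
  next
    assume R: "\<forall>X Y. smooth_vfield A X \<longrightarrow> smooth_vfield A Y \<longrightarrow> (\<forall>p. ?W X Y p = 0)"
    show ?L
    proof (intro allI impI)
      fix X Y Z p assume XY: "smooth_vfield A X" "smooth_vfield A Y"
      have "?W X Y p = 0" using R XY by blast
      then have "g43 (\<phi> p) 0 (Z p) = -2 * F9 A \<phi> \<xi> nabla X Y Z p"
        using W[where p = p and X = X and Y = Y and Z = Z] by simp
      then show "F9 A \<phi> \<xi> nabla X Y Z p = 0"
        by (simp add: g43_simps[OF form])
    qed
  qed
qed

end
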